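(* Let $n\geq 2$ and $d\geq 1$ be integers with $\gcd(n,d)=1$, let $r$ be an integer, and let $f_0(q),f_1(q),\ldots,f_{n-1}(q)\in\mathbb Z[q]$. For $0\le k\le n-1$ put $$\hat{f}_k(q)=\sum_{j=0}^k(-1)^jq^{\binom{j+1}{2}}\begin{bmatrix}k\\ j\end{bmatrix}_q f_j(q).$$ Let $a\in\{0,1,\ldots,n-1\}$ be the unique integer with $ad\equiv -r\pmod n$ (i.e. $a=\langle -r/d\rangle_n$). Then, if $n$ is odd, \begin{align*} &q^{d\binom{a+1}2+\frac{(ad+r)(n-1-2a)}{2}}\sum_{k=0}^{n-1} \frac{(q^r;q^d)_k(q^{d-r};q^d)_k}{(q^d;q^d)_k^2}\, q^{dk}f_k(q^d)\\ \equiv\;& (-1)^a\sum_{k=0}^{n-1}\frac{(q^r;q^d)_k(q^{d-r};q^d)_k}{(q^d;q^d)_k^2}\, q^{dk}\hat{f}_k(q^d)\pmod{\Phi_n(q)^2}, \end{align*} and, if $n$ is even, \begin{align*} &q^{d\binom{a+1}2+\frac{(ad+r)(n-1-2a)}{2}}\sum_{k=0}^{n-1} \frac{(q^r;q^d)_k(q^{d-r};q^d)_k}{(q^d;q^d)_k^2}\, q^{dk}f_k(q^d)\\ \equiv\;& (-1)^{a+\frac{ad+r}{n}}\sum_{k=0}^{n-1}\frac{(q^r;q^d)_k(q^{d-r};q^d)_k}{(q^d;q^d)_k^2}\, q^{dk}\hat{f}_k(q^d)\pmod{\Phi_n(q)^2}. \end{align*} Here $\hat f_k(q^d)$ and $f_k(q^d)$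 denote the polynomials $\hat f_k$, $f_k$ evaluated at $q^d$.
   Context: For $x$ and an integer $n\ge 0$, $(x;q)_n=(1-x)(1-xq)\cdots(1-xq^{n-1})$ for $n\ge1$ and $(x;q)_0=1$. The $q$-binomial coefficient is $\begin{bmatrix}\alpha\\ k\end{bmatrix}_q=\frac{(q^{\alpha-k+1};q)_k}{(q;q)_k}$ for $k\ge 0$ (and $0$ for $k<0$); for integers $0\le j\le k$ this is the Gaussian binomial coefficient. $\Phi_n(q)$ is the $n$-th cyclotomic polynomial. Since $r$ may be negative, the expressions are rational functions in $q$ whose denominators (powers of $q$ and factors $1-q^{dj}$ with $1\le j\le n-1$) are coprime to $\Phi_n(q)$; a congruence $A\equiv B\pmod{\Phi_n(q)^2}$ between such rational functions means that $A-B=\Phi_n(q)^2\,P(q)/Q(q)$ with $P,Q\in\mathbb Z[q]$ and $Q$ coprime to $\Phi_n(q)$. Note that $ad+r$ is divisible by $n$, so $\frac{ad+r}{n}$ is an integer, and the exponent $\frac{(ad+r)(n-1-2a)}{2}$ is an integer. *)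

theory Defs
  imports Complex_Main "HOL-Computational_Algebra.Polynomial" "HOL-Computational_Algebra.Fraction_Field"
begin

definition qpoch :: "'a::comm_ring_1 \<Rightarrow> 'a \<Rightarrow> nat \<Rightarrow> 'a" where
  "qpoch x q k = (\<Prod>i<k. 1 - x * q ^ i)"

definition qbinom :: "'a::field \<Rightarrow> int \<Rightarrow> nat \<Rightarrow> 'a" where
  "qbinom q \<alpha> k = qpoch (q powi (\<alpha> - int k + 1)) q k / qpoch q q k"

definition cyclotomic :: "nat \<Rightarrow> int poly" where
  "cyclotomic n = (THE p. map_poly of_int p =
      (\<Prod>k\<in>{k. k < n \<and> coprime k n}. [:- cis (2 * pi * real k / real n), 1:] :: complex poly))"

definition qvar :: "int poly fract" where
  "qvar = Fract [:0, 1:] 1"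

definition ev :: "int poly \<Rightarrow> int poly fract \<Rightarrow> int poly fract" where
  "ev p x = poly (map_poly (\<lambda>c. Fract [:c:] 1) p) x"

definition cong_cyc2 :: "nat \<Rightarrow> int poly fract \<Rightarrow> int poly fract \<Rightarrow> bool" where
  "cong_cyc2 n A B \<longleftrightarrow> (\<exists>P Q. Q \<noteq> 0 \<and> coprime Q (cyclotomic n) \<and>
      A - B = Fract ((cyclotomic n)^2 * P) Q)"

end

(* Put p = q^d, z = q^n and a d + r = n m, so that q^r = z^m p^(-a) and q^(d-r) = p^(a+1) z^(-m).
   Regard both sides as functions of the integer m.  For m = 0 the sums terminate at k = a, and the
   q-Chu-Vandermonde sum yields an exact identity; m = d is the same situation with a replaced by
   n - 1 - a.  Since z is congruent to 1 modulo Phi_n, every expression built from powers z^m is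
   congruent modulo Phi_n^2 to A + m B Phi_n.  The difference of the two sides has this form and
   vanishes at m = 0 and m = d, and d is invertible in the localization, so it vanishes modulo
   Phi_n^2 for every m.  The power of q on the left hand side becomes w^m with w congruent to 1:
   w = z^((n-1-2a)/2) for odd n, and w = (-q^(n/2))^(n-1-2a) for even n, which explains the extra
   sign in that case. *)

theory Submission
  imports Defs "HOL-Computational_Algebra.Fundamental_Theorem_Algebra"
begin

section \<open>The exact identity\<close>

lemma qpoch_0 [simp]: "qpoch x p 0 = 1"
  by (simp add: qpoch_def)

lemma qpoch_Suc: "qpoch x p (Suc k) = qpoch x p k * (1 - x * p ^ k)"
  by (simp add: qpoch_def)

lemma qpoch_add: "qpoch x p (i + j) = qpoch x p i * qpoch (x * p ^ i) p j"
  by (induction j) (simp_all add: qpoch_Suc power_add mult_ac)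

lemma qpoch_Suc_shift: "qpoch x p (Suc k) = (1 - x) * qpoch (x * p) p k"
  using qpoch_add[of x p 1 k] by (simp add: qpoch_Suc)

lemma qpoch_eq_0:
  assumes "x * p ^ i = 1" "i < k"
  shows "qpoch x p k = 0"
  using assms unfolding qpoch_def by (intro prod_zero) auto

lemma qpoch_self_nonzero:
  fixes p :: "'a::field"
  assumes "\<forall>i>0. p ^ i \<noteq> 1"
  shows "qpoch p p k \<noteq> 0"
  using assms by (simp add: qpoch_def flip: power_Suc)

section \<open>The q-Chu-Vandermonde summation\<close>

text \<open>Coefficients of the terminating basic hypergeometric sum. When \<open>p\<close> is
  nonzero and no positive power of it is 1, this is \<open>(-1)^i * p^(i(i+1)/2 - N i)\<close> times
  the Gaussian binomial of \<open>N\<close> over \<open>i\<close>.\<close>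

definition qvand :: "'a::field \<Rightarrow> nat \<Rightarrow> nat \<Rightarrow> 'a" where
  "qvand p N i = qpoch (inverse p ^ N) p i * p ^ i / qpoch p p i"

lemma qvand_0 [simp]: "qvand p N 0 = 1"
  by (simp add: qvand_def)

lemma qvand_eq_0:
  assumes "p \<noteq> 0" "N < i"
  shows "qvand p N i = 0"
  using assms qpoch_eq_0[of "inverse p ^ N" p N i]
  by (simp add: qvand_def flip: power_mult_distrib)

text \<open>A Pascal-type rule that drives the induction below. Splitting off the first factor of
  \<open>qpoch (inverse p ^ Suc N) p (Suc i)\<close> leaves
  \<open>qpoch (inverse p ^ N) p i\<close>, which all three terms then share.\<close>

lemma qvand_Suc_Suc:
  fixes p :: "'a::field"
  assumes p: "p \<noteq> 0" and nr: "\<forall>i>0. p ^ i \<noteq> 1"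
  shows "qvand p (Suc N) (Suc i) = qvand p N (Suc i) - inverse p ^ N * qvand p N i"
proof -
  have nz: "qpoch p p i \<noteq> 0" "1 - p * p ^ i \<noteq> 0"
    using qpoch_self_nonzero[OF nr] nr[rule_format, of "Suc i"] by auto
  have "qpoch (inverse p ^ Suc N) p (Suc i) = (1 - inverse p ^ Suc N) * qpoch (inverse p ^ N) p i"
    using p by (simp add: qpoch_Suc_shift field_simps)
  then show ?thesis
    using p nz by (simp add: qvand_def qpoch_Suc divide_simps) (simp add: algebra_simps)
qed

text \<open>The usual sum has \<open>qpoch c p i\<close> in the denominator; multiplication by
  \<open>qpoch c p N\<close> turns its reciprocal into
  \<open>qpoch (c * p ^ i) p (N - i)\<close>.\<close>

lemma q_chu_vandermonde:
  fixes p :: "'a::field"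
  assumes p: "p \<noteq> 0" and nr: "\<forall>i>0. p ^ i \<noteq> 1"
  shows "(\<Sum>i\<le>N. qvand p N i * qpoch b p i * qpoch (c * p ^ i) p (N - i)) = (\<Prod>i<N. b - c * p ^ i)"
proof (induction N arbitrary: b c)
  case 0
  then show ?case by simp
next
  case (Suc N)
  let ?F = "\<lambda>N b c i. qpoch b p i * qpoch (c * p ^ i) p (N - i)"
  \<comment> \<open>The last factor of \<open>qpoch (c * p ^ i) p (Suc N - i)\<close> is
    \<open>1 - c * p ^ N\<close> for every \<open>i\<close>, so it can be pulled out of the
    sum.\<close>
  have low: "?F (Suc N) b c i = ?F N b c i * (1 - c * p ^ N)" if "i \<le> N" for i
    using that by (simp add: Suc_diff_le qpoch_Suc mult_ac flip: power_add)
  have "(\<Sum>i\<le>Suc N. qvand p (Suc N) i * ?F (Suc N) b c i)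
      = ?F (Suc N) b c 0 + (\<Sum>i\<le>N. qvand p (Suc N) (Suc i) * ?F (Suc N) b c (Suc i))"
    by (subst sum.atMost_Suc_shift) simp
  \<comment> \<open>The Pascal rule leaves one sum for \<open>(b, c)\<close> and one for
    \<open>(b * p, c * p)\<close>, hence the generalization over \<open>b\<close> and
    \<open>c\<close>.\<close>
  also have "\<dots> = (?F (Suc N) b c 0 + (\<Sum>i\<le>N. qvand p N (Suc i) * ?F (Suc N) b c (Suc i)))
      - inverse p ^ N * (\<Sum>i\<le>N. qvand p N i * ?F (Suc N) b c (Suc i))"
    by (simp only: qvand_Suc_Suc[OF p nr] sum_distrib_left left_diff_distrib sum_subtractf) (simp add: mult_ac)
  also have "?F (Suc N) b c 0 + (\<Sum>i\<le>N. qvand p N (Suc i) * ?F (Suc N) b c (Suc i))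
      = (\<Sum>i\<le>Suc N. qvand p N i * ?F (Suc N) b c i)"
    by (subst sum.atMost_Suc_shift) simp
  also have "\<dots> = (\<Sum>i\<le>N. qvand p N i * ?F N b c i) * (1 - c * p ^ N)"
    by (simp add: qvand_eq_0[OF p] sum_distrib_right low mult.assoc)
  also have "(\<Sum>i\<le>N. qvand p N i * ?F (Suc N) b c (Suc i))
      = (1 - b) * (\<Sum>i\<le>N. qvand p N i * ?F N (b * p) (c * p) i)"
    by (simp add: sum_distrib_left qpoch_Suc_shift mult_ac)
  also have "(\<Sum>i\<le>N. qvand p N i * ?F N (b * p) (c * p) i) = p ^ N * (\<Prod>i<N. b - c * p ^ i)"
  proof -
    have "(\<Prod>i<N. b * p - c * p * p ^ i) = (\<Prod>i<N. p * (b - c * p ^ i))"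
      by (intro prod.cong) (simp_all add: algebra_simps)
    then show ?thesis
      using Suc.IH[of "b * p" "c * p"] by (simp add: mult_ac prod.distrib)
  qed
  also have "(\<Sum>i\<le>N. qvand p N i * ?F N b c i) = (\<Prod>i<N. b - c * p ^ i)"
    using Suc.IH[of b c] by (simp add: mult_ac)
  \<comment> \<open>\<open>p ^ N\<close> cancels \<open>inverse p ^ N\<close>, and
    \<open>(1 - c * p ^ N) - (1 - b)\<close> is the new factor \<open>b - c * p ^ N\<close>.\<close>
  also have "(\<Prod>i<N. b - c * p ^ i) * (1 - c * p ^ N) - inverse p ^ N * ((1 - b) * (p ^ N * (\<Prod>i<N. b - c * p ^ i)))
      = (\<Prod>i<Suc N. b - c * p ^ i)"
    using p by (simp add: field_simps)
  finally show ?case by (simp add: mult.assoc)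
qed

text \<open>With \<open>A = q\<^sup>r\<close>, \<open>B = q\<^sup>d\<^sup>-\<^sup>r\<close> and \<open>p = q\<^sup>d\<close> this is the weight of \<open>f\<^sub>k\<close> in the theorem, including the factor \<open>q\<^sup>d\<^sup>k\<close>.\<close>
definition qcoeff :: "'a::field \<Rightarrow> 'a \<Rightarrow> 'a \<Rightarrow> nat \<Rightarrow> 'a" where
  "qcoeff p A B k = qpoch A p k * qpoch B p k / (qpoch p p k)^2 * p ^ k"

text \<open>The hat transform of the theorem, with \<open>p\<close> for q^d and arbitrary field
  elements \<open>g j\<close> for the values of the polynomials at q^d.\<close>

definition qhat :: "'a::field \<Rightarrow> (nat \<Rightarrow> 'a) \<Rightarrow> nat \<Rightarrow> 'a" where
  "qhat p g k = (\<Sum>j=0..k. (-1) ^ j * p ^ (Suc j choose 2) * qbinom p (int k) j * g j)"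

section \<open>Exact duality under the hat transform, the case m = 0\<close>

lemma qbinom_mult_qpoch:
  fixes p :: "'a::field"
  assumes nr: "\<forall>i>0. p ^ i \<noteq> 1"
  shows "qbinom p (int (j + i)) j * (qpoch p p i * qpoch p p j) = qpoch p p (j + i)"
proof -
  have "qbinom p (int (j + i)) j * qpoch p p j = qpoch (p * p ^ i) p j"
    using qpoch_self_nonzero[OF nr] by (simp add: qbinom_def power_int_add_1' nonzero_divide_eq_eq flip: of_nat_Suc)
  then show ?thesis
    by (simp add: qpoch_add add.commute[of j] mult_ac)
qed

lemma choose_two_add: "(Suc (j + N) choose 2) = (Suc j choose 2) + (\<Sum>i<N. Suc (j + i))"
  by (induction N) (simp_all add: numeral_2_eq_2)

text \<open>With \<open>a = j + N\<close>, the left side is, up to the sign \<open>(-1) ^ j\<close>,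
  the coefficient of \<open>g j\<close> in the transformed sum. Substituting
  \<open>k = j + i\<close> makes it a q-Chu-Vandermonde sum of length \<open>N\<close> with
  \<open>b = p ^ (Suc a + j)\<close> and \<open>c = p ^ Suc j\<close>.\<close>

lemma qcoeff_binomial_sum:
  fixes p :: "'a::field"
  assumes p: "p \<noteq> 0" and nr: "\<forall>i>0. p ^ i \<noteq> 1"
  shows "(\<Sum>k=j..j+N. qcoeff p (inverse p ^ (j+N)) (p ^ Suc (j+N)) k * qbinom p (int k) j) * p ^ (Suc j choose 2)
    = (-1) ^ N * p ^ (Suc (j+N) choose 2) * qcoeff p (inverse p ^ (j+N)) (p ^ Suc (j+N)) j"
proof -
  define a where "a = j + N"
  let ?C = "qcoeff p (inverse p ^ a) (p ^ Suc a)"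
  let ?b = "p ^ (Suc a + j)" and ?c = "p ^ Suc j"
  note nz = qpoch_self_nonzero[OF nr]
  have nzj: "qpoch ?c p i \<noteq> 0" for i
    using nz[of "j + i"] by (simp add: qpoch_add)
  \<comment> \<open>Factors depending on \<open>j\<close> alone go into \<open>?C j\<close>; the
    multiplier \<open>qpoch ?c p N\<close> clears the remaining denominator
    \<open>qpoch ?c p i\<close>.\<close>
  have summand: "?C (j + i) * qbinom p (int (j + i)) j * qpoch ?c p N
      = ?C j * (qvand p N i * qpoch ?b p i * qpoch (?c * p ^ i) p (N - i))" if "i \<le> N" for i
  proof -
    have 1: "qpoch (inverse p ^ a) p (j + i) = qpoch (inverse p ^ a) p j * qpoch (inverse p ^ N) p i"
    proof -
      have "inverse p ^ a * p ^ j = inverse p ^ N"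
        using p by (simp add: a_def power_add field_simps)
      then show ?thesis
        by (simp add: qpoch_add)
    qed
    have 2: "qpoch (p ^ Suc a) p (j + i) = qpoch (p ^ Suc a) p j * qpoch ?b p i"
      by (simp add: qpoch_add power_add mult_ac)
    have 3: "qpoch p p (j + i) = qpoch p p j * qpoch ?c p i"
      by (simp add: qpoch_add)
    have 4: "qpoch ?c p N = qpoch ?c p i * qpoch (?c * p ^ i) p (N - i)"
      using qpoch_add[of ?c p i "N - i"] that by simp
    have 5: "qbinom p (int (j + i)) j = qpoch ?c p i / qpoch p p i"
    proof -
      have "qbinom p (int (j + i)) j * (qpoch p p i * qpoch p p j) = qpoch p p j * qpoch ?c p i"
        using qbinom_mult_qpoch[OF nr, of j i] unfolding 3 .
      then have "qbinom p (int (j + i)) j * qpoch p p i = qpoch ?c p i"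
        using nz[of j] by (metis mult.commute mult.left_commute mult_left_cancel)
      then show ?thesis
        using nz[of i] by (metis nonzero_eq_divide_eq)
    qed
    show ?thesis
      unfolding qcoeff_def qvand_def 1 2 3 4 5 using nz[of i] nz[of j] nzj[of i]
      by (simp add: field_simps power2_eq_square power_add)
  qed
  have "(\<Sum>k=j..j+N. ?C k * qbinom p (int k) j) * qpoch ?c p N
      = (\<Sum>i\<le>N. ?C (j + i) * qbinom p (int (j + i)) j * qpoch ?c p N)"
    using sum.shift_bounds_cl_nat_ivl[of "\<lambda>k. ?C k * qbinom p (int k) j" 0 j N]
    by (simp add: sum_distrib_right atMost_atLeast0 add.commute)
  also have "\<dots> = (\<Sum>i\<le>N. ?C j * (qvand p N i * qpoch ?b p i * qpoch (?c * p ^ i) p (N - i)))"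
    by (intro sum.cong refl summand) simp
  also have "\<dots> = ?C j * (\<Prod>i<N. ?b - ?c * p ^ i)"
    by (simp only: q_chu_vandermonde[OF p nr] flip: sum_distrib_left)
  also have "(\<Prod>i<N. ?b - ?c * p ^ i) = (-1) ^ N * p ^ (\<Sum>i<N. Suc (j + i)) * qpoch ?c p N"
  proof -
    \<comment> \<open>Each factor is \<open>- p ^ Suc (j + i)\<close> times
      \<open>1 - p ^ (j + N - i)\<close>. Reversing the order of the latter gives
      \<open>qpoch ?c p N\<close>, which cancels the multiplier.\<close>
    have "(\<Prod>i<N. ?b - ?c * p ^ i) = (\<Prod>i<N. - 1 * p ^ Suc (j + i) * (1 - p ^ Suc (j + (N - Suc i))))"
    proof (intro prod.cong refl)
      fix i assume "i \<in> {..<N}"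
      then have "Suc a + j = Suc (j + i) + Suc (j + (N - Suc i))"
        by (simp add: a_def)
      then have "?b = p ^ Suc (j + i) * p ^ Suc (j + (N - Suc i))"
        by (simp only: power_add)
      then show "?b - ?c * p ^ i = - 1 * p ^ Suc (j + i) * (1 - p ^ Suc (j + (N - Suc i)))"
        by (simp add: algebra_simps power_add)
    qed
    also have "\<dots> = (-1) ^ N * p ^ (\<Sum>i<N. Suc (j + i)) * (\<Prod>i<N. 1 - p ^ Suc (j + (N - Suc i)))"
      by (simp only: prod.distrib power_sum) simp
    also have "(\<Prod>i<N. 1 - p ^ Suc (j + (N - Suc i))) = (\<Prod>i<N. 1 - p ^ Suc (j + i))"
      by (rule prod.nat_diff_reindex)
    also have "\<dots> = qpoch ?c p N"
      by (simp add: qpoch_def power_add mult.assoc)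
    finally show ?thesis .
  qed
  finally have "(\<Sum>k=j..j+N. ?C k * qbinom p (int k) j) = (-1) ^ N * p ^ (\<Sum>i<N. Suc (j + i)) * ?C j"
    using nzj[of N] by (simp add: field_simps)
  then show ?thesis
    by (simp add: a_def choose_two_add power_add mult_ac)
qed

lemma qcoeff_eq_0:
  assumes "p \<noteq> 0" "a < k"
  shows "qcoeff p (inverse p ^ a) B k = 0"
  using assms qpoch_eq_0[of "inverse p ^ a" p a k]
  by (simp add: qcoeff_def flip: power_mult_distrib)

text \<open>The factor \<open>qpoch (inverse p ^ a) p k\<close> cuts both sums off at
  \<open>k = a\<close>. After exchanging the order of summation, each column is evaluated by
  \<open>qcoeff_binomial_sum\<close>, and the signs \<open>(-1) ^ j\<close> and
  \<open>(-1) ^ (a - j)\<close> combine to one independent of \<open>j\<close>.\<close>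

lemma qhat_duality:
  fixes p :: "'a::field"
  assumes p: "p \<noteq> 0" and nr: "\<forall>i>0. p ^ i \<noteq> 1" and "a < n"
  shows "(\<Sum>k<n. qcoeff p (inverse p ^ a) (p ^ Suc a) k * qhat p g k)
    = (-1) ^ a * p ^ (Suc a choose 2) * (\<Sum>k<n. qcoeff p (inverse p ^ a) (p ^ Suc a) k * g k)"
proof -
  let ?C = "qcoeff p (inverse p ^ a) (p ^ Suc a)"
  have trunc: "(\<Sum>k<n. ?C k * h k) = (\<Sum>k\<le>a. ?C k * h k)" for h
    using assms by (intro sum.mono_neutral_right) (auto simp: qcoeff_eq_0)
  have "(\<Sum>k\<le>a. ?C k * qhat p g k)
      = (\<Sum>k\<le>a. \<Sum>j\<le>k. ?C k * qbinom p (int k) j * ((-1) ^ j * p ^ (Suc j choose 2) * g j))"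
    by (simp add: qhat_def sum_distrib_left atMost_atLeast0 mult_ac)
  also have "\<dots> = (\<Sum>j\<le>a. \<Sum>k=j..a. ?C k * qbinom p (int k) j * ((-1) ^ j * p ^ (Suc j choose 2) * g j))"
    by (simp add: sum.Sigma, rule sum.reindex_bij_witness[of _ prod.swap prod.swap]) auto
  also have "\<dots> = (\<Sum>j\<le>a. (-1) ^ a * p ^ (Suc a choose 2) * (?C j * g j))"
  proof (intro sum.cong refl)
    fix j assume "j \<in> {..a}"
    then obtain N where N: "a = j + N"
      by (auto simp: le_iff_add)
    have sgn: "(-1) ^ j * (-1) ^ N = ((-1) ^ a :: 'a)"
      by (simp add: N power_add)
    have "(\<Sum>k=j..a. ?C k * qbinom p (int k) j * ((-1) ^ j * p ^ (Suc j choose 2) * g j))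
        = (\<Sum>k=j..a. ?C k * qbinom p (int k) j) * p ^ (Suc j choose 2) * ((-1) ^ j * g j)"
      unfolding sum_distrib_right by (intro sum.cong) (simp_all add: mult_ac)
    also have "\<dots> = (-1) ^ j * (-1) ^ N * p ^ (Suc a choose 2) * (?C j * g j)"
      unfolding qcoeff_binomial_sum[OF p nr, of j N, folded N] by (simp only: mult_ac)
    finally show "(\<Sum>k=j..a. ?C k * qbinom p (int k) j * ((-1) ^ j * p ^ (Suc j choose 2) * g j))
        = (-1) ^ a * p ^ (Suc a choose 2) * (?C j * g j)"
      unfolding sgn .
  qed
  finally show ?thesis
    unfolding trunc by (simp only: sum_distrib_left)
qed

section \<open>Cyclotomic polynomials\<close>

text \<open>Primitivity is expressed by exact order; \<open>bij_betw_prim_roots\<close> matches it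
  with the \<open>cis\<close> values in \<open>cyclotomic\<close>.\<close>

definition prim_roots :: "nat \<Rightarrow> complex set" where
  "prim_roots n = {z. z ^ n = 1 \<and> (\<forall>m. 0 < m \<and> m < n \<longrightarrow> z ^ m \<noteq> 1)}"

lemma power_mod_of_power_eq_1:
  fixes z :: "'a::monoid_mult"
  assumes "z ^ e = 1"
  shows "z ^ (m mod e) = z ^ m"
proof -
  have "z ^ m = z ^ (e * (m div e) + m mod e)"
    by simp
  also have "\<dots> = z ^ (m mod e)"
    unfolding power_add power_mult by (simp add: assms)
  finally show ?thesis by simp
qed

lemma prim_roots_power_eq_1_iff:
  assumes "z \<in> prim_roots n" "n > 0"
  shows "z ^ m = 1 \<longleftrightarrow> n dvd m"
proof
  assume "z ^ m = 1"
  then have "z ^ (m mod n) = 1"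
    using assms power_mod_of_power_eq_1[of z n m] by (auto simp: prim_roots_def)
  then have "\<not> (0 < m mod n \<and> m mod n < n)"
    using assms(1) unfolding prim_roots_def by blast
  then show "n dvd m"
    using assms(2) by (auto simp: dvd_eq_mod_eq_0)
next
  assume "n dvd m"
  then show "z ^ m = 1"
    using assms(1) by (auto simp: prim_roots_def power_mult elim!: dvdE)
qed

text \<open>Sorting the roots of unity by their exact order, a divisor of \<open>n\<close>, prepares
  the factorization of x^n - 1 into cyclotomic polynomials.\<close>

lemma roots_unity_eq_Union_prim_roots:
  assumes "n > 0"
  shows "{z. z ^ n = 1} = (\<Union>e\<in>{e. e dvd n}. prim_roots e)"
proof (intro equalityI subsetI)
  fix z :: complex assume "z \<in> {z. z ^ n = 1}"
  then have z: "z ^ n = 1" by simp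
  define e where "e = (LEAST e. e > 0 \<and> z ^ e = 1)"
  have e: "e > 0 \<and> z ^ e = 1"
    unfolding e_def by (rule LeastI[of _ n]) (use assms z in auto)
  have "z ^ m \<noteq> 1" if "0 < m \<and> m < e" for m
    using not_less_Least[of m "\<lambda>e. e > 0 \<and> z ^ e = 1"] that by (auto simp: e_def)
  with e have "z \<in> prim_roots e"
    by (simp add: prim_roots_def)
  with e z show "z \<in> (\<Union>e\<in>{e. e dvd n}. prim_roots e)"
    using prim_roots_power_eq_1_iff[of z e n] by auto
next
  fix z :: complex assume "z \<in> (\<Union>e\<in>{e. e dvd n}. prim_roots e)"
  then show "z \<in> {z. z ^ n = 1}"
    by (auto simp: prim_roots_def power_mult elim!: dvdE)
qed

lemma disjoint_prim_roots:
  assumes "e > 0" "e' > 0" "e \<noteq> e'"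
  shows "prim_roots e \<inter> prim_roots e' = {}"
  using assms by (auto simp: prim_roots_def) (metis nat_neq_iff)

lemma finite_prim_roots: "n > 0 \<Longrightarrow> finite (prim_roots n)"
  by (rule finite_subset[OF _ finite_roots_unity[of n]]) (auto simp: prim_roots_def)

text \<open>The root is the \<open>k\<close>-th power of the one with index 1, so only
  \<open>k * m\<close> modulo \<open>n\<close> matters, and the roots with indices below
  \<open>n\<close> are distinct.\<close>

lemma cis_root_power_eq_1_iff:
  assumes "n > 0"
  shows "cis (2 * pi * real k / real n) ^ m = 1 \<longleftrightarrow> n dvd k * m"
proof -
  let ?z = "cis (2 * pi * real k / real n)" and ?u = "\<lambda>k. cis (2 * pi * real k / real n)"
  have "?z ^ m = ?u 1 ^ (k * m)"
    by (simp only: Complex.DeMoivre) (simp add: field_simps)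
  also have "\<dots> = ?u 1 ^ (k * m mod n)"
    by (rule power_mod_of_power_eq_1[symmetric], simp only: Complex.DeMoivre) (use assms in simp)
  also have "\<dots> = ?u (k * m mod n)"
    by (simp only: Complex.DeMoivre) (simp add: field_simps)
  finally have *: "?z ^ m = ?u (k * m mod n)" .
  have "inj_on ?u {..<n}"
    using bij_betw_roots_unity[OF assms] by (simp add: bij_betw_def)
  then have "?u (k * m mod n) = ?u 0 \<longleftrightarrow> k * m mod n = 0"
    using assms by (subst inj_on_eq_iff) auto
  then show ?thesis
    using * by (simp add: dvd_eq_mod_eq_0)
qed

lemma cis_root_in_prim_roots_iff:
  assumes "n > 0"
  shows "cis (2 * pi * real k / real n) \<in> prim_roots n \<longleftrightarrow> coprime k n"
proof
  assume L: "cis (2 * pi * real k / real n) \<in> prim_roots n"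
  show "coprime k n"
  proof (rule ccontr)
    assume "\<not> coprime k n"
    then have "gcd k n > 1"
      using assms by (metis coprime_iff_gcd_eq_1 gcd_pos_nat less_one linorder_neqE_nat neq0_conv)
    then obtain g where g: "g dvd k" "g dvd n" "g > 1"
      by (meson gcd_dvd1 gcd_dvd2)
    \<comment> \<open>A common factor \<open>g > 1\<close> makes \<open>n div g\<close> a smaller
      exponent that already yields 1.\<close>
    then have "n div g < n" "n div g > 0" "n dvd k * (n div g)"
      using assms by (auto simp: dvd_div_eq_0_iff elim!: dvdE)
    then show False
      using L cis_root_power_eq_1_iff[OF assms, of k "n div g"] by (auto simp: prim_roots_def)
  qed
next
  assume "coprime k n"
  then have "n dvd k * m \<longleftrightarrow> n dvd m" for m
    by (simp add: coprime_dvd_mult_right_iff coprime_commute)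
  then show "cis (2 * pi * real k / real n) \<in> prim_roots n"
    unfolding prim_roots_def cis_root_power_eq_1_iff[OF assms] mem_Collect_eq
    by (auto dest: dvd_imp_le)
qed

lemma bij_betw_prim_roots:
  assumes "n > 0"
  shows "bij_betw (\<lambda>k. cis (2 * pi * real k / real n)) {k. k < n \<and> coprime k n} (prim_roots n)"
proof -
  let ?u = "\<lambda>k. cis (2 * pi * real k / real n)"
  note bij = bij_betw_roots_unity[OF assms]
  have "?u ` {k. k < n \<and> coprime k n} = prim_roots n"
  proof (intro equalityI subsetI)
    fix z assume z: "z \<in> prim_roots n"
    then have "z \<in> ?u ` {..<n}"
      using bij by (auto simp: prim_roots_def bij_betw_def)
    with z show "z \<in> ?u ` {k. k < n \<and> coprime k n}"
      using cis_root_in_prim_roots_iff[OF assms] by auto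
  qed (use cis_root_in_prim_roots_iff[OF assms] in auto)
  moreover have "inj_on ?u {k. k < n \<and> coprime k n}"
    using bij by (auto simp: bij_betw_def elim!: inj_on_subset)
  ultimately show ?thesis by (simp add: bij_betw_def)
qed

section \<open>Descent from complex to integer polynomials\<close>

abbreviation cpoly :: "int poly \<Rightarrow> complex poly" where
  "cpoly \<equiv> map_poly of_int"

lemma cpoly_mult: "cpoly (p * q) = cpoly p * cpoly q"
  by (simp add: poly_eq_iff coeff_map_poly coeff_mult)

lemma cpoly_add: "cpoly (p + q) = cpoly p + cpoly q"
  by (simp add: poly_eq_iff coeff_map_poly)

lemma cpoly_diff: "cpoly (p - q) = cpoly p - cpoly q"
  by (simp add: poly_eq_iff coeff_map_poly)

lemma cpoly_prod: "cpoly (\<Prod>i\<in>A. p i) = (\<Prod>i\<in>A. cpoly (p i))"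
  by (induction A rule: infinite_finite_induct) (simp_all add: cpoly_mult)

lemma cpoly_monom: "cpoly (monom c k) = monom (of_int c) k"
  by (simp add: poly_eq_iff coeff_map_poly)

lemma degree_cpoly [simp]: "degree (cpoly p) = degree p"
  by (cases "p = 0") (auto intro: map_poly_degree_eq)

lemma cpoly_inj: "cpoly p = cpoly q \<longleftrightarrow> p = q"
  by (simp add: poly_eq_iff coeff_map_poly)

lemma lead_coeff_cpoly: "lead_coeff (cpoly p) = of_int (lead_coeff p)"
  by (simp add: coeff_map_poly)

lemma prod_linear_factors_eq:
  fixes p :: "'a::idom poly"
  assumes "finite A" "\<And>z. z \<in> A \<Longrightarrow> poly p z = 0" "degree p = card A" "lead_coeff p = 1"
  shows "p = (\<Prod>z\<in>A. [:- z, 1:])"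
  using assms
proof (induction A arbitrary: p rule: finite_induct)
  case empty
  then obtain c where "p = [:c:]"
    by (metis card.empty degree_eq_zeroE)
  with empty show ?case
    by (simp add: one_pCons)
next
  case (insert z A)
  then obtain r where r: "p = [:- z, 1:] * r"
    by (meson dvdE insertI1 poly_eq_0_iff_dvd)
  have lead: "lead_coeff r = 1"
    using insert.prems(3) r lead_coeff_mult[of "[:- z, 1:]" r] by simp
  then have "r \<noteq> 0" by auto
  then have "degree p = Suc (degree r)"
    using r degree_mult_eq[of "[:- z, 1:]" r] by simp
  moreover have "poly r y = 0" if "y \<in> A" for y
    using insert.prems(1)[of y] insert.hyps that by (auto simp: r)
  ultimately have "r = (\<Prod>z\<in>A. [:- z, 1:])"
    using insert lead by (intro insert.IH) auto
  then show ?case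
    using insert.hyps r by simp
qed

text \<open>Uniqueness of division with remainder by a monic polynomial: the quotient over \<open>\<int>\<close> must agree with \<open>h\<close>.\<close>
lemma monic_dvd_descends:
  fixes f g :: "int poly"
  assumes "lead_coeff g = 1" "cpoly f = cpoly g * h"
  shows "\<exists>k. h = cpoly k"
proof -
  have g0: "g \<noteq> 0" using assms(1) by auto
  \<comment> \<open>Pseudo-division scales \<open>f\<close> by a power of the leading coefficient of
    \<open>g\<close>; that coefficient is 1, so this is genuine division with remainder.\<close>
  obtain k r where kr: "pseudo_divmod f g = (k, r)" by fastforce
  have f: "f = g * k + r" and r: "r = 0 \<or> degree r < degree g"
    using pseudo_divmod[OF g0 kr] assms(1) by simp_all
  have "cpoly g * (h - cpoly k) = cpoly r"
    using assms(2) by (simp add: f cpoly_add cpoly_mult algebra_simps)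
  moreover have "cpoly g \<noteq> 0"
    using g0 by (metis cpoly_inj map_poly_0)
  ultimately have "h - cpoly k = 0"
    using r degree_mult_right_le[of "h - cpoly k" "cpoly g"]
    by (metis degree_0 degree_cpoly leD map_poly_0 mult_eq_0_iff mult.commute)
  then show ?thesis by auto
qed

text \<open>Strong induction: in x^n - 1 the factor belonging to the proper divisors of
  \<open>n\<close> is monic and, by induction, integral, so its cofactor is integral by
  \<open>monic_dvd_descends\<close>.\<close>

lemma ex_int_poly_prim_roots:
  assumes "n > 0"
  shows "\<exists>p. cpoly p = (\<Prod>z\<in>prim_roots n. [:- z, 1:])"
  using assms
proof (induction n rule: less_induct)
  case (less n)
  let ?P = "\<lambda>A. \<Prod>z\<in>A. [:- z, 1:] :: complex poly"
  define D where "D = {e. e dvd n \<and> e < n}"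
  have D: "e > 0" "e < n" if "e \<in> D" for e
    using that less.prems by (auto simp: D_def intro: Nat.gr0I)
  have "finite D" by (simp add: D_def)
  have "\<forall>e\<in>D. \<exists>p. cpoly p = ?P (prim_roots e)"
    using less.IH D by blast
  then obtain c where c: "\<And>e. e \<in> D \<Longrightarrow> cpoly (c e) = ?P (prim_roots e)"
    by metis
  define g where "g = (\<Prod>e\<in>D. c e)"
  have union: "{z. z ^ n = 1} = (\<Union>e\<in>D. prim_roots e) \<union> prim_roots n"
  proof -
    have "{e. e dvd n} = insert n D"
      using less.prems by (auto simp: D_def dest: dvd_imp_le)
    then show ?thesis
      using roots_unity_eq_Union_prim_roots[OF less.prems] by auto
  qed
  have g: "cpoly g = ?P (\<Union>e\<in>D. prim_roots e)"
    unfolding g_def cpoly_prod using \<open>finite D\<close> D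
    by (subst prod.UNION_disjoint) (auto simp: c finite_prim_roots disjoint_prim_roots)
  have deg: "degree (monom 1 n - 1 :: complex poly) = n"
  proof (rule antisym)
    show "degree (monom 1 n - 1 :: complex poly) \<le> n"
      by (rule degree_diff_le) (simp_all add: degree_monom_eq)
    show "n \<le> degree (monom 1 n - 1 :: complex poly)"
      using less.prems by (intro le_degree) simp
  qed
  have "monom 1 n - 1 = ?P {z. z ^ n = 1}"
    using less.prems deg
    by (intro prod_linear_factors_eq)
      (auto simp: finite_roots_unity card_roots_unity_eq poly_monom)
  also have "\<dots> = cpoly g * ?P (prim_roots n)"
    unfolding union g using \<open>finite D\<close> D less.prems
    by (intro prod.union_disjoint) (auto simp: finite_prim_roots, use disjoint_prim_roots in blast)
  finally have "cpoly (monom 1 n - 1) = cpoly g * ?P (prim_roots n)"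
    by (simp add: cpoly_diff cpoly_monom)
  moreover have "lead_coeff g = 1"
  proof -
    have "lead_coeff (cpoly g) = 1"
      unfolding g by (simp add: lead_coeff_prod)
    then show ?thesis
      by (simp only: lead_coeff_cpoly of_int_eq_1_iff)
  qed
  ultimately show ?case
    by (metis monic_dvd_descends)
qed

text \<open>Justifies the definite description in \<open>cyclotomic\<close>: existence is
  \<open>ex_int_poly_prim_roots\<close>, uniqueness is injectivity of \<open>cpoly\<close>.\<close>

lemma cpoly_cyclotomic:
  assumes "n > 0"
  shows "cpoly (cyclotomic n) = (\<Prod>z\<in>prim_roots n. [:- z, 1:])"
proof -
  let ?R = "\<Prod>k\<in>{k. k < n \<and> coprime k n}. [:- cis (2 * pi * real k / real n), 1:]"
  have eq: "?R = (\<Prod>z\<in>prim_roots n. [:- z, 1:])"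
    by (rule prod.reindex_bij_betw[OF bij_betw_prim_roots[OF assms]])
  have "\<exists>!p. cpoly p = ?R"
    unfolding eq using ex_int_poly_prim_roots[OF assms] by (auto simp flip: cpoly_inj)
  then have "cpoly (cyclotomic n) = ?R"
    unfolding cyclotomic_def by (rule theI')
  then show ?thesis
    by (simp only: eq)
qed

lemma lead_coeff_cyclotomic: "n > 0 \<Longrightarrow> lead_coeff (cyclotomic n) = 1"
proof -
  assume "n > 0"
  then have "lead_coeff (cpoly (cyclotomic n)) = 1"
    by (simp add: cpoly_cyclotomic lead_coeff_prod del: degree_cpoly)
  then show ?thesis
    by (simp only: lead_coeff_cpoly of_int_eq_1_iff)
qed

lemma poly_cpoly_cyclotomic_eq_0_iff:
  assumes "n > 0"
  shows "poly (cpoly (cyclotomic n)) z = 0 \<longleftrightarrow> z \<in> prim_roots n"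
  using assms by (simp add: cpoly_cyclotomic poly_prod prod_zero_iff finite_prim_roots)

text \<open>The distinct roots give divisibility over the complex numbers; since the divisor is
  monic, the quotient has integer coefficients.\<close>

lemma cyclotomic_dvdI:
  assumes "n > 0" "\<And>z. z \<in> prim_roots n \<Longrightarrow> poly (cpoly p) z = 0"
  shows "cyclotomic n dvd p"
proof -
  have "(\<Prod>z\<in>A. [:- z, 1:]) dvd f" if "finite A" "\<And>z. z \<in> A \<Longrightarrow> poly f z = 0" for A and f :: "complex poly"
    using that
  proof (induction A arbitrary: f rule: finite_induct)
    case (insert z A)
    then obtain h where h: "f = [:- z, 1:] * h"
      by (meson dvdE insertI1 poly_eq_0_iff_dvd)
    have "poly h y = 0" if "y \<in> A" for y
      using insert.prems[of y] insert.hyps that by (auto simp: h)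
    then have "(\<Prod>z\<in>A. [:- z, 1:]) dvd h"
      by (rule insert.IH)
    then show ?case
      using insert.hyps by (simp add: h mult_dvd_mono del: mult_pCons_left)
  qed simp
  then have "cpoly (cyclotomic n) dvd cpoly p"
    using assms by (simp add: cpoly_cyclotomic finite_prim_roots)
  then show ?thesis
    using monic_dvd_descends[OF lead_coeff_cyclotomic[OF assms(1)]]
    by (metis cpoly_inj cpoly_mult dvd_def)
qed

text \<open>A common divisor of positive degree has a complex root, which would be a primitive root
  of unity. A constant one is a unit because its leading coefficient divides 1.\<close>

lemma coprime_cyclotomicI:
  assumes "n > 0" "\<And>z. z \<in> prim_roots n \<Longrightarrow> poly (cpoly p) z \<noteq> 0"
  shows "coprime p (cyclotomic n)"
proof (rule coprimeI)
  fix g assume g: "g dvd p" "g dvd cyclotomic n"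
  then obtain h where h: "cyclotomic n = g * h" by blast
  have "lead_coeff g * lead_coeff h = 1"
    using lead_coeff_cyclotomic[OF assms(1)] by (simp only: h lead_coeff_mult)
  then have unit: "is_unit (lead_coeff g)" by (metis dvd_triv_left)
  have "degree g = 0"
  proof (rule ccontr)
    assume "degree g \<noteq> 0"
    then have "\<not> constant (poly (cpoly g))"
      by (simp add: constant_degree)
    then obtain z where z: "poly (cpoly g) z = 0"
      using fundamental_theorem_of_algebra by blast
    then have "z \<in> prim_roots n"
      using poly_cpoly_cyclotomic_eq_0_iff[OF assms(1), of z] by (simp add: h cpoly_mult)
    then show False
      using assms(2)[of z] g(1) z by (auto simp: cpoly_mult elim!: dvdE)
  qed
  then show "is_unit g"
    using unit by (metis degree_0_id is_unit_const_poly_iff)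
qed

section \<open>Functions that are affine modulo a square\<close>

text \<open>Abstracts from the localization used later. Such a ring need not be closed under
  inversion, so lemmas assume the inverses they use.\<close>

locale subring_of_field =
  fixes R :: "'a::field set"
  assumes one_closed [simp]: "1 \<in> R"
    and diff_closed [simp]: "x \<in> R \<Longrightarrow> y \<in> R \<Longrightarrow> x - y \<in> R"
    and mult_closed [simp]: "x \<in> R \<Longrightarrow> y \<in> R \<Longrightarrow> x * y \<in> R"
begin

lemma zero_closed [simp]: "0 \<in> R"
  using diff_closed[of 1 1] by simp

lemma uminus_closed [simp]: "x \<in> R \<Longrightarrow> - x \<in> R"
  using diff_closed[of 0 x] by simp

lemma add_closed [simp]: "x \<in> R \<Longrightarrow> y \<in> R \<Longrightarrow> x + y \<in> R"
  using diff_closed[of x "- y"] by simp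

lemma power_closed [simp]: "x \<in> R \<Longrightarrow> x ^ k \<in> R"
  by (induction k) simp_all

lemma of_nat_closed [simp]: "of_nat k \<in> R"
  by (induction k) simp_all

lemma of_int_closed [simp]: "of_int k \<in> R"
  by (cases k) (simp_all del: of_nat_Suc)

lemma sum_closed: "(\<And>i. i \<in> A \<Longrightarrow> h i \<in> R) \<Longrightarrow> sum h A \<in> R"
  by (induction A rule: infinite_finite_induct) simp_all

lemma prod_closed: "(\<And>i. i \<in> A \<Longrightarrow> h i \<in> R) \<Longrightarrow> prod h A \<in> R"
  by (induction A rule: infinite_finite_induct) simp_all

lemma qpoch_closed: "x \<in> R \<Longrightarrow> p \<in> R \<Longrightarrow> qpoch x p k \<in> R"
  unfolding qpoch_def by (intro prod_closed) simp

lemma powi_closed: "x \<in> R \<Longrightarrow> inverse x \<in> R \<Longrightarrow> x powi k \<in> R"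
  by (simp add: power_int_def)

lemma poly_closed:
  assumes "x \<in> R" "\<And>i. coeff p i \<in> R"
  shows "poly p x \<in> R"
  unfolding poly_altdef by (intro sum_closed) (simp add: assms)

end

locale affine_mod_square = subring_of_field R for R :: "'a::field set" +
  fixes \<phi> :: 'a
  assumes modulus_closed [simp]: "\<phi> \<in> R"
begin

text \<open>The slope carries a factor \<open>\<phi>\<close>. This closes the class under products,
  because the term quadratic in \<open>m\<close> is then absorbed by
  \<open>\<phi>\<^sup>2\<close>.\<close>

definition affine :: "(int \<Rightarrow> 'a) \<Rightarrow> bool" where
  "affine g \<longleftrightarrow> (\<exists>A\<in>R. \<exists>B\<in>R. \<forall>m. \<exists>s\<in>R. g m = A + of_int m * \<phi> * B + \<phi>\<^sup>2 * s)"

lemma affine_const: "c \<in> R \<Longrightarrow> affine (\<lambda>m. c)"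
  unfolding affine_def
  by (rule bexI[of _ c], rule bexI[of _ 0], intro allI, rule bexI[of _ 0]) simp_all

lemma affine_diff:
  assumes "affine g" "affine h"
  shows "affine (\<lambda>m. g m - h m)"
proof -
  obtain A B where AB: "A \<in> R" "B \<in> R" "\<And>m. \<exists>s\<in>R. g m = A + of_int m * \<phi> * B + \<phi>\<^sup>2 * s"
    using assms(1) unfolding affine_def by blast
  obtain A' B' where AB': "A' \<in> R" "B' \<in> R" "\<And>m. \<exists>s\<in>R. h m = A' + of_int m * \<phi> * B' + \<phi>\<^sup>2 * s"
    using assms(2) unfolding affine_def by blast
  have "\<exists>s\<in>R. g m - h m = (A - A') + of_int m * \<phi> * (B - B') + \<phi>\<^sup>2 * s" for m
  proof -
    obtain s s' where s: "s \<in> R" "s' \<in> R"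
      "g m = A + of_int m * \<phi> * B + \<phi>\<^sup>2 * s" "h m = A' + of_int m * \<phi> * B' + \<phi>\<^sup>2 * s'"
      using AB(3)[of m] AB'(3)[of m] by blast
    then show ?thesis
      by (intro bexI[of _ "s - s'"]) (simp_all add: algebra_simps)
  qed
  then show ?thesis
    unfolding affine_def using AB AB' diff_closed by blast
qed

lemma affine_mult:
  assumes "affine g" "affine h"
  shows "affine (\<lambda>m. g m * h m)"
proof -
  obtain A B where AB: "A \<in> R" "B \<in> R" "\<And>m. \<exists>s\<in>R. g m = A + of_int m * \<phi> * B + \<phi>\<^sup>2 * s"
    using assms(1) unfolding affine_def by blast
  obtain A' B' where AB': "A' \<in> R" "B' \<in> R" "\<And>m. \<exists>s\<in>R. h m = A' + of_int m * \<phi> * B' + \<phi>\<^sup>2 * s"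
    using assms(2) unfolding affine_def by blast
  have "\<exists>s\<in>R. g m * h m = A * A' + of_int m * \<phi> * (A * B' + A' * B) + \<phi>\<^sup>2 * s" for m
  proof -
    obtain s s' where s: "s \<in> R" "s' \<in> R"
      "g m = A + of_int m * \<phi> * B + \<phi>\<^sup>2 * s" "h m = A' + of_int m * \<phi> * B' + \<phi>\<^sup>2 * s'"
      using AB(3)[of m] AB'(3)[of m] by blast
    let ?m = "of_int m :: 'a"
    let ?t = "?m * ?m * B * B' + s * A' + A * s' + ?m * \<phi> * (B * s' + s * B') + \<phi> * \<phi> * s * s'"
    have "?t \<in> R"
      using s AB AB' by (intro add_closed mult_closed) simp_all
    moreover have "g m * h m = A * A' + ?m * \<phi> * (A * B' + A' * B) + \<phi>\<^sup>2 * ?t"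
      unfolding s by (simp add: algebra_simps power2_eq_square)
    ultimately show ?thesis by blast
  qed
  moreover have "A * A' \<in> R" "A * B' + A' * B \<in> R"
    using AB AB' by simp_all
  ultimately show ?thesis
    unfolding affine_def by blast
qed

lemma affine_uminus: "affine g \<Longrightarrow> affine (\<lambda>m. - g m)"
  using affine_diff[OF affine_const[of 0]] by simp

lemma affine_add: "affine g \<Longrightarrow> affine h \<Longrightarrow> affine (\<lambda>m. g m + h m)"
  using affine_diff[of g "\<lambda>m. - h m"] affine_uminus[of h] by simp

lemma affine_sum: "(\<And>i. i \<in> A \<Longrightarrow> affine (g i)) \<Longrightarrow> affine (\<lambda>m. \<Sum>i\<in>A. g i m)"
  by (induction A rule: infinite_finite_induct) (simp_all add: affine_const affine_add)

lemma affine_prod: "(\<And>i. i \<in> A \<Longrightarrow> affine (g i)) \<Longrightarrow> affine (\<lambda>m. \<Prod>i\<in>A. g i m)"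
  by (induction A rule: infinite_finite_induct) (simp_all add: affine_const affine_mult)

lemma affine_qpoch: "affine g \<Longrightarrow> p \<in> R \<Longrightarrow> affine (\<lambda>m. qpoch (g m) p k)"
  unfolding qpoch_def by (intro affine_prod affine_diff affine_mult affine_const) simp_all

text \<open>The binomial expansion to first order, also for negative exponents. The property
  \<open>P\<close> is multiplicative with exponents adding, so it suffices to check it for
  \<open>y\<close> and \<open>inverse y\<close>.\<close>

lemma powi_expansion:
  assumes e: "e \<in> R" and inv: "inverse (1 + \<phi> * e) \<in> R"
  shows "\<exists>s\<in>R. (1 + \<phi> * e) powi m = 1 + of_int m * \<phi> * e + \<phi>\<^sup>2 * s"
proof -
  define y where "y = 1 + \<phi> * e"
  define P where "P = (\<lambda>x m. \<exists>s\<in>R. x = 1 + of_int m * \<phi> * e + \<phi>\<^sup>2 * s)"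
  have P_mult: "P (x * x') (m + m')" if x: "P x m" "P x' m'" for x x' m m'
  proof -
    obtain s s' where s: "s \<in> R" "s' \<in> R"
      "x = 1 + of_int m * \<phi> * e + \<phi>\<^sup>2 * s" "x' = 1 + of_int m' * \<phi> * e + \<phi>\<^sup>2 * s'"
      using x unfolding P_def by blast
    let ?m = "of_int m :: 'a" and ?m' = "of_int m' :: 'a"
    let ?t = "?m * ?m' * e * e + s + s' + \<phi> * e * (?m * s' + ?m' * s) + \<phi> * \<phi> * s * s'"
    have "?t \<in> R"
      using s e by (intro add_closed mult_closed) simp_all
    moreover have "x * x' = 1 + of_int (m + m') * \<phi> * e + \<phi>\<^sup>2 * ?t"
      unfolding s by (simp add: algebra_simps power2_eq_square)
    ultimately show ?thesis
      unfolding P_def by blast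
  qed
  have P_y: "P y 1"
    unfolding P_def y_def by (rule bexI[of _ 0]) simp_all
  have "P (y powi m) m"
  proof (cases "y = 0")
    \<comment> \<open>As \<open>inverse 0 = 0\<close>, the assumption on the inverse admits
      \<open>y = 0\<close>. Then \<open>\<phi> * e = - 1\<close>, so \<open>\<phi>\<^sup>2\<close>
      is a unit of the ring and divides everything.\<close>
    case True
    then have "\<phi> * e = - 1"
      by (simp add: y_def eq_neg_iff_add_eq_0 add.commute)
    then have unit: "\<phi>\<^sup>2 * e\<^sup>2 = 1"
      by (metis power_mult_distrib power2_minus one_power2)
    show ?thesis
      unfolding P_def
    proof (rule bexI)
      let ?t = "y powi m - 1 - of_int m * \<phi> * e"
      have "y powi m \<in> R"
        using True by (intro powi_closed) simp_all
      then show "e\<^sup>2 * ?t \<in> R"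
        using e by simp
      show "y powi m = 1 + of_int m * \<phi> * e + \<phi>\<^sup>2 * (e\<^sup>2 * ?t)"
        unfolding mult.assoc[symmetric, of "\<phi>\<^sup>2"] unit by simp
    qed
  next
    case False
    have P_inv: "P (inverse y) (- 1)"
      unfolding P_def
    proof (rule bexI)
      show "e\<^sup>2 * inverse y \<in> R"
        using e inv by (simp add: y_def)
      \<comment> \<open>The witness comes from dividing
        \<open>y * (1 - \<phi> * e) = 1 - (\<phi> * e)\<^sup>2\<close> by \<open>y\<close>.\<close>
      have "y * (1 - \<phi> * e + \<phi>\<^sup>2 * (e\<^sup>2 * inverse y)) = y * (1 - \<phi> * e) + (\<phi> * e)\<^sup>2"
        using False by (simp add: algebra_simps)
      also have "\<dots> = 1"
        by (simp add: y_def algebra_simps power2_eq_square)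
      finally have "inverse y = 1 - \<phi> * e + \<phi>\<^sup>2 * (e\<^sup>2 * inverse y)"
        by (rule inverse_unique)
      then show "inverse y = 1 + of_int (- 1) * \<phi> * e + \<phi>\<^sup>2 * (e\<^sup>2 * inverse y)"
        by simp
    qed
    show ?thesis
    proof (induction m rule: int_induct[where k = 0])
      case base
      show ?case
        unfolding P_def by (rule bexI[of _ 0]) simp_all
    next
      case (step1 i)
      then show ?case
        using P_mult[OF _ P_y, of "y powi i" i] False by (simp add: power_int_add)
    next
      case (step2 i)
      then show ?case
        using P_mult[OF _ P_inv, of "y powi i" i] False by (simp add: power_int_diff field_simps)
    qed
  qed
  then show ?thesis
    by (simp add: P_def y_def)
qed

lemma affine_powi:
  assumes "e \<in> R" "inverse (1 + \<phi> * e) \<in> R"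
  shows "affine (\<lambda>m. (1 + \<phi> * e) powi m)"
  unfolding affine_def using assms powi_expansion by (intro bexI[of _ 1] bexI[of _ e]) simp_all

lemma affine_reflect:
  assumes "affine g"
  shows "affine (\<lambda>m. g (- m))"
proof -
  obtain A B where AB: "A \<in> R" "B \<in> R" "\<And>m. \<exists>s\<in>R. g m = A + of_int m * \<phi> * B + \<phi>\<^sup>2 * s"
    using assms(1) unfolding affine_def by blast
  have "\<exists>s\<in>R. g (- m) = A + of_int m * \<phi> * (- B) + \<phi>\<^sup>2 * s" for m
    using AB(3)[of "- m"] by simp
  then show ?thesis
    unfolding affine_def using AB uminus_closed by blast
qed

text \<open>The zero at 0 makes \<open>A\<close> a multiple of \<open>\<phi>\<^sup>2\<close>; the
  zero at \<open>d\<close> then does the same for \<open>of_nat d * \<phi> * B\<close>, and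
  \<open>d\<close> is invertible.\<close>

lemma affine_two_zeros:
  assumes aff: "affine g" and zeros: "g 0 = 0" "g (int d) = 0"
    and d: "of_nat d \<noteq> (0 :: 'a)" "inverse (of_nat d) \<in> R"
  shows "\<exists>s\<in>R. g m = \<phi>\<^sup>2 * s"
proof -
  obtain A B where AB: "A \<in> R" "B \<in> R" "\<And>m. \<exists>s\<in>R. g m = A + of_int m * \<phi> * B + \<phi>\<^sup>2 * s"
    using aff unfolding affine_def by blast
  obtain s t u where stu: "s \<in> R" "t \<in> R" "u \<in> R"
    "g 0 = A + \<phi>\<^sup>2 * s" "g (int d) = A + of_nat d * \<phi> * B + \<phi>\<^sup>2 * t"
    "g m = A + of_int m * \<phi> * B + \<phi>\<^sup>2 * u"
    using AB(3)[of 0] AB(3)[of "int d"] AB(3)[of m] by auto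
  have A: "A = - (\<phi>\<^sup>2 * s)"
    using stu(4) zeros(1) by (simp add: eq_neg_iff_add_eq_0)
  have "of_nat d * (\<phi> * B) = \<phi>\<^sup>2 * (s - t)"
    using stu(5) zeros(2) unfolding A by (simp add: algebra_simps)
  then have B: "\<phi> * B = \<phi>\<^sup>2 * ((s - t) * inverse (of_nat d))"
    using d(1) by (simp add: field_simps)
  have "g m = \<phi>\<^sup>2 * (u - s + of_int m * ((s - t) * inverse (of_nat d)))"
    unfolding stu(6) mult.assoc B A by (simp add: algebra_simps)
  moreover have "u - s + of_int m * ((s - t) * inverse (of_nat d)) \<in> R"
    using stu d(2) by simp
  ultimately show ?thesis by blast
qed

end

section \<open>The duality congruence by interpolation in m\<close>

lemma qcoeff_commute: "qcoeff p A B k = qcoeff p B A k"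
  by (simp add: qcoeff_def mult_ac)

context subring_of_field
begin

lemma qhat_closed:
  assumes p: "p \<in> R" "inverse p \<in> R" "\<forall>k<n. inverse (qpoch p p k) \<in> R"
    and "k < n" "\<forall>j<n. g j \<in> R"
  shows "qhat p g k \<in> R"
  unfolding qhat_def
proof (intro sum_closed mult_closed power_closed)
  fix j assume "j \<in> {0..k}"
  then have "inverse (qpoch p p j) \<in> R" "g j \<in> R"
    using assms by simp_all
  then show "g j \<in> R" "qbinom p (int k) j \<in> R"
    using p by (simp_all add: qbinom_def divide_inverse qpoch_closed powi_closed)
qed (use p in simp_all)

end

context affine_mod_square
begin

text \<open>\<open>1 + \<phi> * e\<close> is z and \<open>1 + \<phi> * e'\<close> is w. The equation
  for z^d turns \<open>m = d\<close> into the exact duality for \<open>n - 1 - a\<close>, the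
  equation for w^d makes the prefactors agree there, and \<open>affine_two_zeros\<close> covers
  every other \<open>m\<close>.\<close>

lemma qhat_duality_cong:
  assumes "a < n" and p: "p \<in> R" "inverse p \<in> R" "p \<noteq> 0" "\<forall>i>0. p ^ i \<noteq> 1"
    and qp: "\<forall>k<n. inverse (qpoch p p k) \<in> R"
    and e: "e \<in> R" "inverse (1 + \<phi> * e) \<in> R" "(1 + \<phi> * e) ^ d = p ^ n"
    and e': "e' \<in> R" "inverse (1 + \<phi> * e') \<in> R"
      "(1 + \<phi> * e') ^ d * p ^ (Suc a choose 2) = (-1) ^ (n - 1) * p ^ (Suc (n - 1 - a) choose 2)"
    and d: "of_nat d \<noteq> (0 :: 'a)" "inverse (of_nat d) \<in> R"
    and g: "\<forall>k<n. g k \<in> R"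
  defines "T \<equiv> \<lambda>h m. \<Sum>k<n. qcoeff p ((1 + \<phi> * e) powi m * inverse p ^ a) ((1 + \<phi> * e) powi (- m) * p ^ Suc a) k * h k"
  shows "\<exists>s\<in>R. (1 + \<phi> * e') powi m * p ^ (Suc a choose 2) * T g m - (-1) ^ a * T (qhat p g) m = \<phi>\<^sup>2 * s"
proof -
  let ?z = "1 + \<phi> * e" and ?w = "1 + \<phi> * e'"
  have z: "affine (\<lambda>m. ?z powi m)" "affine (\<lambda>m. ?z powi (- m))"
    using affine_powi[OF e(1,2)] affine_reflect by blast+
  have aff_T: "affine (T h)" if h: "\<forall>k<n. h k \<in> R" for h
    unfolding T_def qcoeff_def divide_inverse
  proof (intro affine_sum affine_mult affine_qpoch z affine_const p power_closed)
    fix k assume "k \<in> {..<n}"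
    then show "inverse ((qpoch p p k)\<^sup>2) \<in> R" "h k \<in> R"
      using qp h by (simp_all flip: power_inverse)
  qed
  let ?D = "\<lambda>m. ?w powi m * p ^ (Suc a choose 2) * T g m - (-1) ^ a * T (qhat p g) m"
  have "affine ?D"
    by (intro affine_diff affine_mult affine_const affine_powi e' aff_T)
      (use p qp g in \<open>auto intro: qhat_closed\<close>)
  moreover have "?D 0 = 0"
    by (simp add: T_def qhat_duality[OF p(3,4) \<open>a < n\<close>] flip: power_Suc power_add)
  moreover have "?D (int d) = 0"
  proof -
    define b where "b = n - 1 - a"
    have n: "n = Suc a + b"
      using \<open>a < n\<close> by (simp add: b_def)
    \<comment> \<open>At \<open>m = d\<close> the two parameters become \<open>p ^ Suc b\<close> and
      \<open>inverse p ^ b\<close>: those of the exact identity for \<open>b\<close>, in exchanged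
      order.\<close>
    have A: "?z powi int d * inverse p ^ a = p ^ Suc b"
      using p(3) by (simp add: e(3) n power_add field_simps)
    have B: "?z powi (- int d) * p ^ Suc a = inverse p ^ b"
      using p(3) by (simp add: e(3) n power_add power_int_minus field_simps)
    have T: "T h (int d) = (\<Sum>k<n. qcoeff p (inverse p ^ b) (p ^ Suc b) k * h k)" for h
      unfolding T_def A B by (simp only: qcoeff_commute[of p "p ^ Suc b"])
    have hat: "T (qhat p g) (int d) = (-1) ^ b * p ^ (Suc b choose 2) * T g (int d)"
      unfolding T by (rule qhat_duality) (use p n in auto)
    have "(-1) ^ (n - 1) = (-1 :: 'a) ^ a * (-1) ^ b"
      by (simp add: n power_add)
    then have w: "?w powi int d * p ^ (Suc a choose 2) = (-1) ^ a * (-1) ^ b * p ^ (Suc b choose 2)"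
      using e'(3) by (simp add: b_def)
    show ?thesis
      unfolding hat w by (simp only: mult.assoc diff_self)
  qed
  ultimately show ?thesis
    by (intro affine_two_zeros[where g = ?D]) (use d in auto)
qed

text \<open>Allows w to be defined as an integer power of z, or of \<open>- (q ^ l)\<close> for even
  \<open>n\<close>, in the form that \<open>qhat_duality_cong\<close> expects.\<close>

lemma powi_one_plus:
  assumes "e \<in> R" "inverse (1 + \<phi> * e) \<in> R"
  obtains e' where "e' \<in> R" "(1 + \<phi> * e) powi h = 1 + \<phi> * e'" "inverse (1 + \<phi> * e') \<in> R"
proof -
  obtain s where s: "s \<in> R" "(1 + \<phi> * e) powi h = 1 + of_int h * \<phi> * e + \<phi>\<^sup>2 * s"
    using powi_expansion[OF assms] by blast
  have eq: "(1 + \<phi> * e) powi h = 1 + \<phi> * (of_int h * e + \<phi> * s)"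
    by (simp add: s(2) algebra_simps power2_eq_square)
  have "inverse ((1 + \<phi> * e) powi h) \<in> R"
    using powi_closed[of "1 + \<phi> * e" "- h"] assms by (simp add: power_int_minus)
  then have "inverse (1 + \<phi> * (of_int h * e + \<phi> * s)) \<in> R"
    by (simp only: eq)
  with eq show thesis
    using s assms by (intro that[of "of_int h * e + \<phi> * s"]) simp_all
qed

end

section \<open>The localization at the cyclotomic polynomial\<close>

text \<open>Non-vanishing at the primitive roots is visibly stable under products of denominators;
  \<open>coprime_cyclotomicI\<close> translates it into coprimality.\<close>

definition cyc_local :: "nat \<Rightarrow> int poly fract set" where
  "cyc_local n = {Fract P Q | P Q. Q \<noteq> 0 \<and> (\<forall>z\<in>prim_roots n. poly (cpoly Q) z \<noteq> 0)}"

lemma Fract_in_cyc_local: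
  "Q \<noteq> 0 \<Longrightarrow> (\<And>z. z \<in> prim_roots n \<Longrightarrow> poly (cpoly Q) z \<noteq> 0) \<Longrightarrow> Fract P Q \<in> cyc_local n"
  by (auto simp: cyc_local_def)

lemma Fract_1_in_cyc_local [simp]: "Fract P 1 \<in> cyc_local n"
  by (rule Fract_in_cyc_local) simp_all

lemma inverse_Fract_1_in_cyc_local:
  assumes "P \<noteq> 0" "\<And>z. z \<in> prim_roots n \<Longrightarrow> poly (cpoly P) z \<noteq> 0"
  shows "inverse (Fract P 1) \<in> cyc_local n"
  using assms by (auto intro: Fract_in_cyc_local)

lemma subring_cyc_local: "subring_of_field (cyc_local n)"
proof
  show "1 \<in> cyc_local n"
    by (simp add: One_fract_def)
  fix x y assume "x \<in> cyc_local n" "y \<in> cyc_local n"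
  then obtain P Q P' Q' where "x = Fract P Q" "y = Fract P' Q'" "Q \<noteq> 0" "Q' \<noteq> 0"
    "\<forall>z\<in>prim_roots n. poly (cpoly Q) z \<noteq> 0" "\<forall>z\<in>prim_roots n. poly (cpoly Q') z \<noteq> 0"
    unfolding cyc_local_def by blast
  then show "x - y \<in> cyc_local n" "x * y \<in> cyc_local n"
    by (auto intro!: Fract_in_cyc_local simp: cpoly_mult)
qed

lemma affine_mod_square_cyc_local: "affine_mod_square (cyc_local n) (Fract (cyclotomic n) 1)"
  by (intro affine_mod_square.intro affine_mod_square_axioms.intro subring_cyc_local) simp

lemma cong_cyc2I:
  assumes "n > 0" "A - B = (Fract (cyclotomic n) 1)\<^sup>2 * s" "s \<in> cyc_local n"
  shows "cong_cyc2 n A B"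
proof -
  obtain P Q where "s = Fract P Q" "Q \<noteq> 0" "\<forall>z\<in>prim_roots n. poly (cpoly Q) z \<noteq> 0"
    using assms(3) unfolding cyc_local_def by blast
  then show ?thesis
    unfolding cong_cyc2_def using assms(1,2)
    by (intro exI[of _ P] exI[of _ Q]) (auto intro: coprime_cyclotomicI simp: power2_eq_square)
qed

section \<open>Elements and units of the localization\<close>

lemma qvar_power: "qvar ^ k = Fract (monom 1 k) 1"
  by (induction k) (simp_all add: qvar_def One_fract_def monom_0 monom_Suc flip: one_pCons)

lemma qvar_nonzero: "qvar \<noteq> 0"
  by (simp add: qvar_def Zero_fract_def eq_fract)

lemma one_minus_qvar_power: "1 - qvar ^ k = Fract (1 - monom 1 k) 1"
  by (simp add: qvar_power One_fract_def)

lemma monom_1_eq_1_iff: "monom (1 :: 'a :: comm_semiring_1) k = 1 \<longleftrightarrow> k = 0"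
  by (metis degree_1 degree_monom_eq monom_0 one_pCons zero_neq_one)

lemma qvar_power_neq_1: "k > 0 \<Longrightarrow> qvar ^ k \<noteq> 1"
  by (simp add: qvar_power One_fract_def eq_fract monom_1_eq_1_iff)

lemma qvar_in_cyc_local [simp]: "qvar \<in> cyc_local n"
  by (simp add: qvar_def)

lemma inverse_qvar_in_cyc_local: "n > 0 \<Longrightarrow> inverse qvar \<in> cyc_local n"
  unfolding qvar_def
  by (rule inverse_Fract_1_in_cyc_local) (auto simp: prim_roots_def map_poly_pCons power_0_left)

lemma inverse_one_minus_qvar_power_in_cyc_local:
  assumes "n > 0" "\<not> n dvd k"
  shows "inverse (1 - qvar ^ k) \<in> cyc_local n"
  unfolding one_minus_qvar_power
proof (rule inverse_Fract_1_in_cyc_local)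
  have "k \<noteq> 0" using assms(2) by (intro notI) simp
  then show "1 - monom 1 k \<noteq> (0 :: int poly)"
    using monom_1_eq_1_iff[of k] by (metis right_minus_eq)
  show "poly (cpoly (1 - monom 1 k)) z \<noteq> 0" if "z \<in> prim_roots n" for z
    using prim_roots_power_eq_1_iff[OF that assms(1), of k] assms(2)
    by (auto simp: cpoly_diff cpoly_monom poly_monom)
qed

lemma inverse_qpoch_in_cyc_local:
  assumes "coprime n d" "k < n"
  shows "inverse (qpoch (qvar ^ d) (qvar ^ d) k) \<in> cyc_local n"
proof -
  interpret subring_of_field "cyc_local n"
    by (rule subring_cyc_local)
  have "inverse (1 - qvar ^ d * (qvar ^ d) ^ i) \<in> cyc_local n" if "i < k" for i
  proof -
    \<comment> \<open>Coprimality reduces this to \<open>n\<close> not dividing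
      \<open>Suc i\<close>, and \<open>0 < Suc i < n\<close>.\<close>
    have "\<not> n dvd d * Suc i"
      using assms that by (auto simp: coprime_dvd_mult_right_iff simp del: mult_Suc_right dest: dvd_imp_le)
    then have "inverse (1 - qvar ^ (d * Suc i)) \<in> cyc_local n"
      using assms by (intro inverse_one_minus_qvar_power_in_cyc_local) auto
    then show ?thesis
      by (simp add: power_mult power_add)
  qed
  then show ?thesis
    unfolding qpoch_def prod_inversef[symmetric] by (intro prod_closed) simp
qed

lemma inverse_of_nat_in_cyc_local:
  assumes "k > 0"
  shows "inverse (of_nat k) \<in> cyc_local n"
  unfolding of_nat_fract
  using assms by (intro inverse_Fract_1_in_cyc_local) (simp_all add: of_nat_poly map_poly_pCons)

lemma of_nat_fract_poly_nonzero: "k > 0 \<Longrightarrow> of_nat k \<noteq> (0 :: int poly fract)"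
  by (simp add: of_nat_fract Zero_fract_def eq_fract)

lemma ev_in_cyc_local:
  assumes "x \<in> cyc_local n"
  shows "ev p x \<in> cyc_local n"
proof -
  interpret subring_of_field "cyc_local n"
    by (rule subring_cyc_local)
  have "coeff (map_poly (\<lambda>c. Fract [:c:] 1) p) i \<in> cyc_local n" for i
    by (subst coeff_map_poly) (simp_all add: Zero_fract_def)
  then show ?thesis
    unfolding ev_def using assms by (intro poly_closed)
qed

lemma qvar_power_n_expansion:
  assumes "n > 0"
  obtains e where "e \<in> cyc_local n" "qvar ^ n = 1 + Fract (cyclotomic n) 1 * e"
proof -
  have "cyclotomic n dvd monom 1 n - 1"
    using assms by (intro cyclotomic_dvdI) (auto simp: cpoly_diff cpoly_monom poly_monom prim_roots_def)
  then obtain h where "monom 1 n - 1 = cyclotomic n * h" ..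
  then have "monom 1 n = 1 + cyclotomic n * h"
    by (simp add: algebra_simps)
  then show thesis
    by (intro that[of "Fract h 1"]) (simp_all add: qvar_power One_fract_def)
qed

text \<open>At a primitive root \<open>z\<close> of even order the square of \<open>z ^ l\<close> is
  1 but \<open>z ^ l\<close> is not, so it is -1. This supplies the base of w for even
  \<open>n\<close>.\<close>

lemma qvar_half_power_expansion:
  assumes "n = 2 * l" "l > 0"
  obtains e where "e \<in> cyc_local n" "- (qvar ^ l) = 1 + Fract (cyclotomic n) 1 * e"
proof -
  have "z ^ l = - 1" if "z \<in> prim_roots n" for z
  proof -
    have "z ^ l \<noteq> 1" "(z ^ l)\<^sup>2 = 1"
      using that assms by (auto simp: prim_roots_def mult.commute simp flip: power_mult)
    then show ?thesis
      by (simp add: power2_eq_1_iff)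
  qed
  then have "cyclotomic n dvd monom 1 l + 1"
    using assms by (intro cyclotomic_dvdI) (auto simp: cpoly_add cpoly_monom poly_monom)
  then obtain h where "monom 1 l + 1 = cyclotomic n * h" ..
  then have "- monom 1 l = 1 + cyclotomic n * (- h)"
    by (simp add: algebra_simps eq_neg_iff_add_eq_0)
  then show thesis
    by (intro that[of "Fract (- h) 1"]) (simp_all add: qvar_power One_fract_def)
qed

section \<open>Specialization to q^d and the two parities of n\<close>

lemma two_times_Suc_choose_two: "2 * int (Suc a choose 2) = int a * (int a + 1)"
  by (induction a) (simp_all add: numeral_2_eq_2 algebra_simps)

theorem theorem1p1:
  fixes n d a :: nat and r :: int and f :: "nat \<Rightarrow> int poly"
  assumes "n \<ge> 2" and "d \<ge> 1" and "coprime n d"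
    and "a < n" and "(int a * int d) mod int n = (- r) mod int n"
  defines "q \<equiv> qvar"
  defines "fhat \<equiv> (\<lambda>k x. \<Sum>j=0..k. (-1) ^ j * x ^ (Suc j choose 2) * qbinom x (int k) j * ev (f j) x)"
  defines "S \<equiv> (\<lambda>g. \<Sum>k<n. qpoch (q powi r) (q ^ d) k * qpoch (q powi (int d - r)) (q ^ d) k
                   / (qpoch (q ^ d) (q ^ d) k)^2 * q ^ (d * k) * g k)"
  defines "E \<equiv> int d * int (Suc a choose 2) + (int a * int d + r) * (int n - 1 - 2 * int a) div 2"
  shows "(odd n \<longrightarrow> cong_cyc2 n (q powi E * S (\<lambda>k. ev (f k) (q ^ d)))
                          ((-1) ^ a * S (\<lambda>k. fhat k (q ^ d))))
       \<and> (even n \<longrightarrow> cong_cyc2 n (q powi E * S (\<lambda>k. ev (f k) (q ^ d)))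
                          ((-1) powi (int a + (int a * int d + r) div int n) * S (\<lambda>k. fhat k (q ^ d))))"
proof -
  define \<phi> where "\<phi> = Fract (cyclotomic n) 1"
  interpret affine_mod_square "cyc_local n" \<phi>
    unfolding \<phi>_def by (rule affine_mod_square_cyc_local)
  have n: "n > 0" using assms(1) by simp
  have q0: "q \<noteq> 0" and qR: "q \<in> cyc_local n" "inverse q \<in> cyc_local n"
    using inverse_qvar_in_cyc_local[OF n] by (simp_all add: q_def qvar_nonzero)
  define p where "p = q ^ d"
  have p: "p \<in> cyc_local n" "inverse p \<in> cyc_local n" "p \<noteq> 0" "\<forall>i>0. p ^ i \<noteq> 1"
    using q0 qR \<open>d \<ge> 1\<close> qvar_power_neq_1
    by (simp_all add: p_def q_def flip: power_mult power_inverse)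
  have "int n dvd int a * int d + r"
    using assms(5) by (metis diff_minus_eq_add mod_eq_dvd_iff)
  then obtain m where m: "int a * int d + r = int n * m" ..
  then have r: "r = int n * m - int d * int a"
    by (simp add: algebra_simps)
  define t where "t = int n - 1 - 2 * int a"
  \<comment> \<open>The triangular numbers for \<open>n - 1 - a\<close> and \<open>a\<close> differ
    by \<open>n * t / 2\<close>; the doubled form postpones the halving to the parity split.\<close>
  have choose: "2 * int (Suc (n - 1 - a) choose 2) = 2 * int (Suc a choose 2) + int n * t"
    unfolding two_times_Suc_choose_two t_def using assms(4) by (simp add: of_nat_diff algebra_simps)
  obtain e where e: "e \<in> cyc_local n" "q ^ n = 1 + \<phi> * e"
    using qvar_power_n_expansion[OF n] unfolding \<phi>_def q_def by blast
  have qn: "inverse (1 + \<phi> * e) \<in> cyc_local n" "(1 + \<phi> * e) ^ d = p ^ n"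
    using qR(2) by (simp_all add: p_def mult.commute flip: e(2) power_mult power_inverse)
  have p_powi: "p ^ k = q powi (int d * int k)" for k
    by (simp add: p_def power_mult power_int_mult)
  have T: "S h = (\<Sum>k<n. qcoeff p ((1 + \<phi> * e) powi m * inverse p ^ a) ((1 + \<phi> * e) powi (- m) * p ^ Suc a) k * h k)" for h
  proof -
    have "q powi r = (1 + \<phi> * e) powi m * inverse p ^ a"
      using q0 by (simp add: r power_int_diff power_int_power power_inverse p_powi divide_inverse flip: e(2))
    moreover have "q powi (int d - r) = q powi (int n * (- m)) * q powi (int d * int (Suc a))"
      using q0 by (simp add: r algebra_simps flip: power_int_add)
    then have "q powi (int d - r) = (1 + \<phi> * e) powi (- m) * p ^ Suc a"
      unfolding p_powi power_int_power[symmetric] e(2) .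
    ultimately show ?thesis
      by (simp only: S_def qcoeff_def power_mult flip: p_def)
  qed
  define G where "G = (\<lambda>k. ev (f k) p)"
  have hat: "(\<lambda>k. fhat k (q ^ d)) = qhat p G"
    by (simp add: fhat_def qhat_def G_def p_def fun_eq_iff)
  \<comment> \<open>The sign by which \<open>q powi E\<close> differs from w^m times the triangular
    power of \<open>p\<close>.\<close>
  define \<epsilon> :: "int poly fract" where "\<epsilon> = (if even n then (-1) powi m else 1)"
  have \<epsilon>: "\<epsilon> * \<epsilon> = 1" "\<epsilon> \<in> cyc_local n"
    by (auto simp: \<epsilon>_def power_int_minus_left)
  \<comment> \<open>One w has to serve twice: \<open>wd\<close> fixes its d-th power for the zero at
    \<open>m = d\<close>, and \<open>wm\<close> recovers the exponent \<open>E\<close> at the actual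
    \<open>m\<close>.\<close>
  obtain e' where e': "e' \<in> cyc_local n" "inverse (1 + \<phi> * e') \<in> cyc_local n"
    and wd: "(1 + \<phi> * e') ^ d * p ^ (Suc a choose 2) = (-1) ^ (n - 1) * p ^ (Suc (n - 1 - a) choose 2)"
    and wm: "q powi E = \<epsilon> * ((1 + \<phi> * e') powi m * p ^ (Suc a choose 2))"
  proof (cases "odd n")
    case True
    \<comment> \<open>Halving \<open>t\<close> lets w be the integer power z^h, with no
      sign.\<close>
    then have "even t"
      by (simp add: t_def)
    then obtain h where h: "t = 2 * h" ..
    obtain e' where e': "e' \<in> cyc_local n" "(1 + \<phi> * e) powi h = 1 + \<phi> * e'" "inverse (1 + \<phi> * e') \<in> cyc_local n"
      using powi_one_plus[OF e(1) qn(1)] by blast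
    have w: "1 + \<phi> * e' = q powi (int n * h)"
      by (simp add: power_int_power flip: e'(2) e(2))
    show thesis
    proof (rule that[OF e'(1,3)])
      have "int n * h * int d + int d * int (Suc a choose 2) = int d * int (Suc (n - 1 - a) choose 2)"
      proof -
        have "int (Suc (n - 1 - a) choose 2) = int (Suc a choose 2) + int n * h"
          using choose unfolding h by simp
        then show ?thesis
          by (simp only: distrib_left mult_ac add.commute)
      qed
      then show "(1 + \<phi> * e') ^ d * p ^ (Suc a choose 2) = (-1) ^ (n - 1) * p ^ (Suc (n - 1 - a) choose 2)"
        using True q0 unfolding w p_powi by (simp add: power_int_power' flip: power_int_add)
      have "E = int n * h * m + int d * int (Suc a choose 2)"
        unfolding E_def t_def[symmetric] m h by simp
      then show "q powi E = \<epsilon> * ((1 + \<phi> * e') powi m * p ^ (Suc a choose 2))"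
        using True q0 unfolding w p_powi by (simp add: \<epsilon>_def power_int_add power_int_mult)
    qed
  next
    case False
    then obtain l where l: "n = 2 * l" "l > 0"
      using n by (metis evenE nat_0_less_mult_iff)
    \<comment> \<open>Odd \<open>t\<close> gives w = \<open>(- (q ^ l)) powi t\<close> a minus sign;
      odd \<open>d\<close>, forced by coprimality, keeps it in w^d, as
      \<open>(-1) ^ (n - 1) = -1\<close> demands.\<close>
    have odd: "odd t" "odd d"
      using assms(3) by (simp_all add: t_def l(1))
    obtain e1 where e1: "e1 \<in> cyc_local n" "- (q ^ l) = 1 + \<phi> * e1"
      using qvar_half_power_expansion[OF l] unfolding \<phi>_def q_def by blast
    have "inverse (1 + \<phi> * e1) \<in> cyc_local n"
      using qR(2) by (simp flip: e1(2) power_inverse)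
    then obtain e' where e': "e' \<in> cyc_local n" "(1 + \<phi> * e1) powi t = 1 + \<phi> * e'" "inverse (1 + \<phi> * e') \<in> cyc_local n"
      using powi_one_plus[OF e1(1)] by blast
    have w: "1 + \<phi> * e' = - (q powi (int l * t))"
      using odd by (simp add: power_int_power flip: e'(2) e1(2))
    show thesis
    proof (rule that[OF e'(1,3)])
      have "int l * t * int d + int d * int (Suc a choose 2) = int d * int (Suc (n - 1 - a) choose 2)"
      proof -
        have "int (Suc (n - 1 - a) choose 2) = int (Suc a choose 2) + int l * t"
          using choose l(1) by simp
        then show ?thesis
          by (simp only: distrib_left mult_ac add.commute)
      qed
      then show "(1 + \<phi> * e') ^ d * p ^ (Suc a choose 2) = (-1) ^ (n - 1) * p ^ (Suc (n - 1 - a) choose 2)"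
        using False odd q0 n unfolding w p_powi by (simp add: power_int_power' flip: power_int_add)
      have "E = int l * t * m + int d * int (Suc a choose 2)"
        unfolding E_def t_def[symmetric] m unfolding l(1) by simp
      moreover have "(- (q powi (int l * t))) powi m = \<epsilon> * q powi (int l * t * m)"
        using False by (simp add: \<epsilon>_def power_int_mult power_int_minus_left)
      ultimately show "q powi E = \<epsilon> * ((1 + \<phi> * e') powi m * p ^ (Suc a choose 2))"
        using q0 \<epsilon>(1) unfolding w p_powi by (simp add: power_int_add flip: mult.assoc)
    qed
  qed
  have "\<exists>s\<in>cyc_local n. (1 + \<phi> * e') powi m * p ^ (Suc a choose 2) * S G - (-1) ^ a * S (qhat p G) = \<phi>\<^sup>2 * s"
    unfolding T
  proof (rule qhat_duality_cong[OF assms(4) p _ e(1) qn e' wd])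
    show "\<forall>k<n. inverse (qpoch p p k) \<in> cyc_local n"
      using inverse_qpoch_in_cyc_local[OF assms(3)] by (simp add: p_def q_def)
    show "of_nat d \<noteq> (0 :: int poly fract)" "inverse (of_nat d) \<in> cyc_local n"
      using assms(2) by (simp_all add: of_nat_fract_poly_nonzero inverse_of_nat_in_cyc_local)
    show "\<forall>k<n. G k \<in> cyc_local n"
      using p(1) by (simp add: G_def ev_in_cyc_local)
  qed
  then obtain s where s: "s \<in> cyc_local n"
    "(1 + \<phi> * e') powi m * p ^ (Suc a choose 2) * S G - (-1) ^ a * S (qhat p G) = \<phi>\<^sup>2 * s"
    by blast
  \<comment> \<open>Multiplying by \<open>\<epsilon>\<close> restores \<open>q powi E\<close> on the
    left and moves the sign to the transformed sum.\<close>
  have "q powi E * S G - (-1) ^ a * \<epsilon> * S (qhat p G)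
      = \<epsilon> * ((1 + \<phi> * e') powi m * p ^ (Suc a choose 2) * S G - (-1) ^ a * S (qhat p G))"
    unfolding wm by (simp add: algebra_simps)
  also have "\<dots> = \<phi>\<^sup>2 * (\<epsilon> * s)"
    unfolding s(2) by simp
  finally have "cong_cyc2 n (q powi E * S G) ((-1) ^ a * \<epsilon> * S (qhat p G))"
    unfolding \<phi>_def by (rule cong_cyc2I[OF n]) (use s(1) \<epsilon>(2) in simp)
  moreover have "(-1) powi (int a + (int a * int d + r) div int n) = ((-1) ^ a * (-1) powi m :: int poly fract)"
    using n by (simp add: m power_int_add)
  ultimately show ?thesis
    unfolding hat by (cases "even n") (simp_all add: G_def \<epsilon>_def flip: p_def)
qed

end
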